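(* Let $n,m$ be nonnegative integers. Then the mapping $\pi$ restricts to a bijection from ${\mathcal{P}_{n,m}^{+}(D,EENN)}^{-}$ to $\mathcal{P}_{n,m}(NE,EN)$, and the mapping $\delta$ restricts to a bijection from $\mathcal{P}_{n,m}(NE,EN)$ to ${\mathcal{P}_{n,m}^{+}(D,EENN)}^{-}$.
   Context: A lattice path is a finite sequence $(v_1,\dots,v_k)$ of points of $\mathbb{Z}^2$; its steps are the differences $v_{i+1}-v_i$, and the path is identified with its starting point together with the word of its steps. Write $N=(0,1)$, $E=(1,0)$, $D=(1,1)$. A path is Delannoy if every step belongs to $\{N,E,D\}$. $\mathcal{P}_{n,m}$ is the set of Delannoy paths from the origin $(0,0)$ to $(n,m)$. A path contains a pattern (a word in $N,E,D$) if this word occurs as a block of consecutive steps; $\mathcal{P}_{n,m}(\omega_1,\dots,\omega_r)$ is the set of paths in $\mathcal{P}_{n,m}$ containing none of the patterns $\omega_1,\dots,\omega_r$. Thus $\mathcal{P}_{n,m}(D)$ is the set of paths from $(0,0)$ to $(n,m)$ with steps $N,E$ only. A peak is a consecutive $NE$, a valley is a consecutive $EN$, and a deep valley is a consecutive $EENN$. The augmented path $P^{+}$ of $P$ is obtained by adding an $E$ step before the first point of $P$ and an $N$ step after the last point of $P$ (as words, $P^{+}=E\,P\,N$). ${\mathcal{P}_{n,m}^{+}(D,EENN)}^{-}$ denotes the set of all $P\in\mathcal{P}_{n,m}$ such that the augmented path $P^{+}$ contains neither a diagonal step $D$ nor a deep valley $EENN$. The mapping $\pi:\mathcal{P}_{n,m}(D)\to\mathcal{P}_{n,m}(NE)$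 replaces each peak $NE$ of a path by a diagonal step $D$ (all peaks replaced simultaneously). The mapping $\delta:\mathcal{P}_{n,m}(NE)\to\mathcal{P}_{n,m}(D)$ replaces each diagonal step $D$ of a path by a peak $NE$. *)

theory Defs
  imports Main "HOL-Library.Sublist" "HOL-Library.Product_Plus"
begin

text \<open>
  A lattice path is a nonempty list of points of $\mathbb{Z}^2$; steps and points are both pairs
  of integers, with componentwise addition and subtraction.
\<close>

type_synonym point = "int \<times> int"

definition north :: point where "north = (0, 1)"
definition east :: point where "east = (1, 0)"
definition diag :: point where "diag = (1, 1)"

fun steps :: "point list \<Rightarrow> point list" where
  "steps (p # q # v) = (q - p) # steps (q # v)"
| "steps v = []"

text \<open>
  The path with a given starting point and a given word of steps. The lemmas below make precise
  the identification of a path with its starting point and its word.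
\<close>

fun path_of :: "point \<Rightarrow> point list \<Rightarrow> point list" where
  "path_of p [] = [p]"
| "path_of p (s # w) = p # path_of (p + s) w"

lemma path_of_not_Nil [simp]: "path_of p w \<noteq> []"
  by (cases w) auto

lemma hd_path_of [simp]: "hd (path_of p w) = p"
  by (cases w) auto

lemma steps_path_of [simp]: "steps (path_of p w) = w"
proof (induction w arbitrary: p)
  case (Cons s w)
  show ?case
    using Cons[of "p + s"] by (cases w) auto
qed simp

lemma path_of_steps: "v \<noteq> [] \<Longrightarrow> path_of (hd v) (steps v) = v"
  by (induction v rule: steps.induct) auto

definition delannoy_paths :: "nat \<Rightarrow> nat \<Rightarrow> point list set" where
  "delannoy_paths n m =
     {v. v \<noteq> [] \<and> hd v = (0, 0) \<and> last v = (int n, int m) \<and>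
         set (steps v) \<subseteq> {north, east, diag}}"

text \<open>
  \<^const>\<open>sublist\<close> is the relation of being a block of consecutive entries.
\<close>

definition avoids :: "point list \<Rightarrow> point list set \<Rightarrow> bool" where
  "avoids v \<Omega> \<longleftrightarrow> (\<forall>\<omega>\<in>\<Omega>. \<not> sublist \<omega> (steps v))"

definition avoiding_paths :: "nat \<Rightarrow> nat \<Rightarrow> point list set \<Rightarrow> point list set" where
  "avoiding_paths n m \<Omega> = {v \<in> delannoy_paths n m. avoids v \<Omega>}"

definition augment :: "point list \<Rightarrow> point list" where
  "augment v = (hd v - east) # v @ [last v + north]"

lemma steps_snoc: "v \<noteq> [] \<Longrightarrow> steps (v @ [q]) = steps v @ [q - last v]"
  by (induction v rule: steps.induct) auto

lemma steps_augment: "v \<noteq> [] \<Longrightarrow> steps (augment v) = east # steps v @ [north]"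
  using steps_snoc[of v "last v + north"] by (cases v) (auto simp: augment_def)

definition augmented_avoiding_paths :: "nat \<Rightarrow> nat \<Rightarrow> point list set \<Rightarrow> point list set" where
  "augmented_avoiding_paths n m \<Omega> = {v \<in> delannoy_paths n m. avoids (augment v) \<Omega>}"

text \<open>
  Distinct occurrences of the word $NE$ never overlap, so the left-to-right scan below replaces
  all the peaks of the original word simultaneously.
\<close>

fun replace_peaks :: "point list \<Rightarrow> point list" where
  "replace_peaks (s # t # w) =
     (if s = north \<and> t = east then diag # replace_peaks w else s # replace_peaks (t # w))"
| "replace_peaks w = w"

definition replace_diags :: "point list \<Rightarrow> point list" where
  "replace_diags w = concat (map (\<lambda>s. if s = diag then [north, east] else [s]) w)"

text \<open>
  The mappings $\pi$ and $\delta$ are total functions on point lists; they are only meant to be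
  used on $\mathcal{P}_{n,m}(D)$ and $\mathcal{P}_{n,m}(NE)$ respectively.
\<close>

definition peaks_to_diags :: "point list \<Rightarrow> point list" where
  "peaks_to_diags v = path_of (hd v) (replace_peaks (steps v))"

definition diags_to_peaks :: "point list \<Rightarrow> point list" where
  "diags_to_peaks v = path_of (hd v) (replace_diags (steps v))"

end

theory Submission imports Defs begin

text \<open>
  On words, expanding diagonals and contracting peaks are mutually inverse once there is no
  diagonal on one side and no peak on the other. An $EN$ of a word without peaks is never preceded
  by $N$ nor followed by $E$, so after expanding the diagonals it extends to an $EENN$ in the
  augmented word. In an $EENN$ of the augmented word, conversely, neither of the two inner letters
  comes from a diagonal, so the inner $EN$ is already a valley before expansion.
\<close>

lemma step_distinct [simp]:
  "north \<noteq> east" "east \<noteq> north" "north \<noteq> diag" "diag \<noteq> north" "east \<noteq> diag" "diag \<noteq> east"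
  by (auto simp: north_def east_def diag_def)

lemma north_plus_east: "north + east = diag"
  by (simp add: north_def east_def diag_def)

lemma last_path_of: "last (path_of p w) = p + sum_list w"
  by (induction w arbitrary: p) (auto simp: add.assoc)

text \<open>Turns the endpoint condition into one on the sum of the step word, which both
  replacements preserve because \<open>north + east = diag\<close>.\<close>

lemma last_eq_sum_steps: "v \<noteq> [] \<Longrightarrow> last v = hd v + sum_list (steps v)"
  using last_path_of[of "hd v" "steps v"] by (simp add: path_of_steps)

lemma sublist_singleton: "sublist [x] w \<longleftrightarrow> x \<in> set w"
  by (induction w) (auto simp: sublist_Cons_right)

lemma replace_diags_simps [simp]:
  "replace_diags [] = []"
  "replace_diags (s # w) = (if s = diag then north # east # replace_diags w else s # replace_diags w)"
  by (simp_all add: replace_diags_def)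

text \<open>Unfolding by the first letter alone suits structural induction on words; the two-letter
  equations suit \<open>replace_peaks.induct\<close>, where these rules are switched off.\<close>

lemma replace_peaks_simps [simp]:
  "s \<noteq> north \<Longrightarrow> replace_peaks (s # w) = s # replace_peaks w"
  "replace_peaks (north # w) = (case w of [] \<Rightarrow> [north] | t # w' \<Rightarrow>
     if t = east then diag # replace_peaks w' else north # replace_peaks w)"
  by (cases w; simp)+

lemma sum_list_replace_peaks: "sum_list (replace_peaks w) = sum_list w"
  by (induction w rule: replace_peaks.induct)
     (auto simp: north_plus_east[symmetric] add.assoc simp del: replace_peaks_simps)

lemma sum_list_replace_diags: "sum_list (replace_diags w) = sum_list w"
  by (induction w) (auto simp: north_plus_east[symmetric] add.assoc)

lemma set_replace_peaks: "set (replace_peaks w) \<subseteq> insert diag (set w)"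
  by (induction w rule: replace_peaks.induct) (auto simp del: replace_peaks_simps)

lemma set_replace_diags: "set (replace_diags w) \<subseteq> {north, east} \<union> (set w - {diag})"
  by (induction w) auto

lemma replace_diags_replace_peaks:
  "diag \<notin> set w \<Longrightarrow> replace_diags (replace_peaks w) = w"
  by (induction w rule: replace_peaks.induct) (auto simp del: replace_peaks_simps)

text \<open>An expanded diagonal starts with \<open>north\<close>, so a \<open>north\<close> already
  in \<open>w\<close> is never followed by a newly created \<open>east\<close>. The scan thus
  contracts exactly the expanded diagonals.\<close>

lemma replace_peaks_replace_diags:
  "\<not> sublist [north, east] w \<Longrightarrow> replace_peaks (replace_diags w) = w"
proof (induction w)
  case (Cons s w)
  then show ?case
    by (cases w) (auto simp: sublist_Cons_right)
qed simp

text \<open>Contraction exposes no new peak: the letter after a kept \<open>north\<close> is the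
  original next letter, which is not \<open>east\<close>, or a \<open>diag\<close>.\<close>

lemma replace_peaks_no_peak: "\<not> sublist [north, east] (replace_peaks w)"
proof (induction w rule: replace_peaks.induct)
  case (1 s t w)
  have "replace_peaks (t # w) = [] \<or> hd (replace_peaks (t # w)) \<in> {t, diag}"
    by (cases w) (auto simp del: replace_peaks_simps)
  with 1 show ?case
    by (cases "replace_peaks (t # w)")
       (auto simp: sublist_Cons_right simp del: replace_peaks_simps)
qed (auto simp: sublist_Cons_right simp del: replace_peaks_simps)

text \<open>The outer letters are those of the augmented path. The leading \<open>east\<close> also
  drives the induction: a first letter \<open>east\<close>, or the \<open>east\<close> of an
  expanded diagonal, takes its place before the tail.\<close>

lemma deep_valley_replace_diags_iff:
  assumes "set w \<subseteq> {north, east, diag}" "\<not> sublist [north, east] w"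
  shows "sublist [east, east, north, north] (east # replace_diags w @ [north]) \<longleftrightarrow>
         sublist [east, north] w"
  using assms
proof (induction w)
  case (Cons s w)
  let ?x = "replace_diags w @ [north]"
  have IH: "sublist [east, east, north, north] (east # ?x) \<longleftrightarrow> sublist [east, north] w"
    using Cons by (auto simp: sublist_Cons_right)
  consider "s = east" | "s = north" | "s = diag"
    using Cons.prems(1) by auto
  then show ?case
  proof cases
    case 1
    \<comment> \<open>A deep valley at the front needs \<open>?x\<close> to begin with two norths.
      An expanded diagonal gives only one; a first \<open>north\<close> of \<open>w\<close> is
      followed by \<open>north\<close>, by an expanded diagonal or by the appended
      \<open>north\<close>.\<close>
    have "prefix [north, north] ?x \<longleftrightarrow> prefix [north] w"
    proof (cases w)
      case w: (Cons t w')
      with Cons.prems show ?thesis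
        by (cases w') (auto simp: sublist_Cons_right)
    qed simp
    with 1 IH show ?thesis
      by (auto simp: sublist_Cons_right)
  next
    case 2
    \<comment> \<open>The induction hypothesis has \<open>east\<close> directly before
      \<open>?x\<close>, the present word has \<open>north\<close>. As \<open>?x\<close> does not
      begin with \<open>east\<close>, neither letter starts a deep valley.\<close>
    with Cons.prems(2) have "\<not> prefix [east] ?x"
      by (cases w) (auto simp: sublist_Cons_right)
    then have "\<not> prefix [east, north, north] ?x"
      by (cases ?x) auto
    with 2 IH show ?thesis
      by (simp add: sublist_Cons_right)
  next
    case 3
    with IH show ?thesis
      by (simp add: sublist_Cons_right)
  qed
qed (simp add: sublist_Cons_right)

lemma peaks_to_diags_in:
  assumes "v \<in> augmented_avoiding_paths n m {[diag], [east, east, north, north]}"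
  shows "peaks_to_diags v \<in> avoiding_paths n m {[north, east], [east, north]}"
    and "diags_to_peaks (peaks_to_diags v) = v"
proof -
  let ?w = "steps v" and ?u = "replace_peaks (steps v)"
  have v: "v \<noteq> []" "hd v = (0, 0)" "last v = (int n, int m)" "set ?w \<subseteq> {north, east, diag}"
    and "diag \<notin> set ?w" and deep: "\<not> sublist [east, east, north, north] (east # ?w @ [north])"
    using assms
    by (auto simp: augmented_avoiding_paths_def delannoy_paths_def avoids_def steps_augment
        sublist_singleton)
  then have inv: "replace_diags ?u = ?w"
    by (simp add: replace_diags_replace_peaks)
  then show "diags_to_peaks (peaks_to_diags v) = v"
    using v(1) by (simp add: diags_to_peaks_def peaks_to_diags_def path_of_steps)
  have set_u: "set ?u \<subseteq> {north, east, diag}"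
    using set_replace_peaks[of ?w] v(4) by blast
  \<comment> \<open>The criterion is applied to the contracted word, whose expansion is the original
    word by \<open>inv\<close>.\<close>
  then have "\<not> sublist [east, north] ?u"
    using deep_valley_replace_diags_iff[OF set_u replace_peaks_no_peak] inv deep by simp
  then show "peaks_to_diags v \<in> avoiding_paths n m {[north, east], [east, north]}"
    using v set_u last_eq_sum_steps[OF v(1)]
    by (simp add: avoiding_paths_def delannoy_paths_def avoids_def peaks_to_diags_def
        last_path_of sum_list_replace_peaks replace_peaks_no_peak)
qed

lemma diags_to_peaks_in:
  assumes "v \<in> avoiding_paths n m {[north, east], [east, north]}"
  shows "diags_to_peaks v \<in> augmented_avoiding_paths n m {[diag], [east, east, north, north]}"
    and "peaks_to_diags (diags_to_peaks v) = v"
proof -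
  let ?u = "steps v"
  have v: "v \<noteq> []" "hd v = (0, 0)" "last v = (int n, int m)" "set ?u \<subseteq> {north, east, diag}"
    and peak: "\<not> sublist [north, east] ?u" and valley: "\<not> sublist [east, north] ?u"
    using assms by (auto simp: avoiding_paths_def delannoy_paths_def avoids_def)
  show "peaks_to_diags (diags_to_peaks v) = v"
    using v(1) peak
    by (simp add: diags_to_peaks_def peaks_to_diags_def path_of_steps replace_peaks_replace_diags)
  have "set (replace_diags ?u) \<subseteq> {north, east}"
    using set_replace_diags[of ?u] v(4) by blast
  then show "diags_to_peaks v \<in> augmented_avoiding_paths n m {[diag], [east, east, north, north]}"
    using v valley deep_valley_replace_diags_iff[OF v(4) peak] last_eq_sum_steps[OF v(1)]
    by (auto simp: augmented_avoiding_paths_def delannoy_paths_def avoids_def diags_to_peaks_def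
        last_path_of sum_list_replace_diags steps_augment sublist_singleton)
qed

theorem theorem2:
  fixes n m :: nat
  shows "bij_betw peaks_to_diags
           (augmented_avoiding_paths n m {[diag], [east, east, north, north]})
           (avoiding_paths n m {[north, east], [east, north]}) \<and>
         bij_betw diags_to_peaks
           (avoiding_paths n m {[north, east], [east, north]})
           (augmented_avoiding_paths n m {[diag], [east, east, north, north]})"
proof
  show "bij_betw peaks_to_diags
          (augmented_avoiding_paths n m {[diag], [east, east, north, north]})
          (avoiding_paths n m {[north, east], [east, north]})"
    by (rule bij_betw_byWitness[where f' = diags_to_peaks])
       (use peaks_to_diags_in diags_to_peaks_in in blast)+
  show "bij_betw diags_to_peaks
          (avoiding_paths n m {[north, east], [east, north]})
          (augmented_avoiding_paths n m {[diag], [east, east, north, north]})"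
    by (rule bij_betw_byWitness[where f' = peaks_to_diags])
       (use peaks_to_diags_in diags_to_peaks_in in blast)+
qed

end
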